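(* Let $m>1$, let $X\neq\emptyset$ be a finite set, $k:X\times X\to[0,\infty)$, and assume that the operator $L$ generated by $k$ satisfies the condition $CD_m(0,d)$ for some $d>0$. Suppose that $u:[0,\infty)\times X\to(0,\infty)$ is $C^1$ in time and solves $\partial_t u-Lu^m=0$ on $(0,\infty)\times X$. Then the function $v=\frac{m}{m-1}u^{m-1}$ satisfies $$-Lv\le\frac dt\quad\text{in }(0,\infty)\times X,$$ and thus $$\frac{\tilde{\Psi}_\Upsilon^{(m)}(v)}{(m-1)v}-\frac{\partial_t v}{(m-1)v}\le\frac dt\quad\text{in }(0,\infty)\times X.$$
   Context: For $f:X\to\mathbb{R}$ the operator generated by $k$ is $Lf(x)=\sum_{y\in X}k(x,y)(f(y)-f(x))$; one sets $k(x,x)=0$, and $k$ is assumed nontrivial (not identically zero). For $w:X\to(0,\infty)$ and $m>1$, $$\tilde{\Psi}_\Upsilon^{(m)}(w)(x)=\sum_{y\in X}k(x,y)\Big(\tfrac{m-1}{m}w(x)^2+\tfrac{(m-1)^2}{m}w(x)^{\frac{m-2}{m-1}}w(y)^{\frac{m}{m-1}}-(m-1)w(x)w(y)\Big).$$ For $u:X\to(0,\infty)$ and $m>1$, $$\mathcal{D}_m(u)(x)=m\sum_{y\in X}k(x,y)\big(u^{m-2}(y)Lu^m(y)-u^{m-2}(x)Lu^m(x)\big).$$ Condition $CD_m(0,d)$ at $x\in X$: for every $u:X\to(0,\infty)$ such that $v=\frac{m}{m-1}u^{m-1}$ satisfies $-Lv(x)>0$ and $-Lv(x)\ge-Lv(y)$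 for all $y\in X$ with $k(x,y)>0$, one has $$\mathcal{D}_m(u)(x)\ge\frac1d\big(-Lv(x)\big)^2.$$ $L$ satisfies $CD_m(0,d)$ if it satisfies it at every $x\in X$. For functions of $(t,x)$, the operators act in the variable $x$ for each fixed $t$. *)

theory Defs
  imports "HOL-Analysis.Analysis"
begin

text \<open>
  The state space is a carrier set \<open>X\<close>. Kernels and functions are total on the ambient type,
  but they are only ever evaluated on \<open>X\<close>. All powers of functions are taken pointwise with
  \<open>powr\<close>, which is used at positive bases only.
\<close>

definition kernel_on :: "'a set \<Rightarrow> ('a \<Rightarrow> 'a \<Rightarrow> real) \<Rightarrow> bool" where
  "kernel_on X k \<longleftrightarrow>
     (\<forall>x\<in>X. \<forall>y\<in>X. 0 \<le> k x y) \<and> (\<forall>x\<in>X. k x x = 0) \<and> (\<exists>x\<in>X. \<exists>y\<in>X. k x y \<noteq> 0)"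

definition gen :: "'a set \<Rightarrow> ('a \<Rightarrow> 'a \<Rightarrow> real) \<Rightarrow> ('a \<Rightarrow> real) \<Rightarrow> 'a \<Rightarrow> real" where
  "gen X k f x = (\<Sum>y\<in>X. k x y * (f y - f x))"

definition pressure :: "real \<Rightarrow> ('a \<Rightarrow> real) \<Rightarrow> 'a \<Rightarrow> real" where
  "pressure m u x = m / (m - 1) * u x powr (m - 1)"

definition Psi_tilde ::
  "'a set \<Rightarrow> ('a \<Rightarrow> 'a \<Rightarrow> real) \<Rightarrow> real \<Rightarrow> ('a \<Rightarrow> real) \<Rightarrow> 'a \<Rightarrow> real" where
  "Psi_tilde X k m w x = (\<Sum>y\<in>X. k x y *
     ((m - 1) / m * (w x)\<^sup>2
      + (m - 1)\<^sup>2 / m * w x powr ((m - 2) / (m - 1)) * w y powr (m / (m - 1))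
      - (m - 1) * w x * w y))"

definition DD ::
  "'a set \<Rightarrow> ('a \<Rightarrow> 'a \<Rightarrow> real) \<Rightarrow> real \<Rightarrow> ('a \<Rightarrow> real) \<Rightarrow> 'a \<Rightarrow> real" where
  "DD X k m u x = m * (\<Sum>y\<in>X. k x y *
     (u y powr (m - 2) * gen X k (\<lambda>z. u z powr m) y
      - u x powr (m - 2) * gen X k (\<lambda>z. u z powr m) x))"

definition CD_at :: "'a set \<Rightarrow> ('a \<Rightarrow> 'a \<Rightarrow> real) \<Rightarrow> real \<Rightarrow> real \<Rightarrow> 'a \<Rightarrow> bool" where
  "CD_at X k m d x \<longleftrightarrow>
     (\<forall>u. (\<forall>y\<in>X. 0 < u y)
        \<longrightarrow> - gen X k (pressure m u) x > 0
        \<longrightarrow> (\<forall>y\<in>X. k x y > 0 \<longrightarrow>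
               - gen X k (pressure m u) x \<ge> - gen X k (pressure m u) y)
        \<longrightarrow> DD X k m u x \<ge> 1 / d * (- gen X k (pressure m u) x)\<^sup>2)"

definition CD :: "'a set \<Rightarrow> ('a \<Rightarrow> 'a \<Rightarrow> real) \<Rightarrow> real \<Rightarrow> real \<Rightarrow> bool" where
  "CD X k m d \<longleftrightarrow> (\<forall>x\<in>X. CD_at X k m d x)"

text \<open>
  Derivatives are taken within \<open>I\<close>, so they are one-sided at endpoints contained in \<open>I\<close>. The
  library's \<open>C1_differentiable_on\<close> asks for two-sided derivatives and would
  constrain a function on \<open>{0..}\<close> also at negative arguments.
\<close>

definition C1_within :: "real set \<Rightarrow> (real \<Rightarrow> real) \<Rightarrow> bool" where
  "C1_within I f \<longleftrightarrow>
     (\<exists>f'. (\<forall>t\<in>I. (f has_real_derivative f' t) (at t within I)) \<and> continuous_on I f')"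

end

theory Submission
  imports Defs
begin

text \<open>
  Along the flow, \<open>\<partial>\<^sub>t(-Lv) = -DD(u)\<close>. Consider a maximum point of \<open>t (-Lv)\<close> over
  \<open>[0, T] \<times> X\<close> with positive value: there \<open>-Lv\<close> is positive and maximal in space, so the curvature
  condition applies, and the left derivative in time is nonnegative, that is
  \<open>-Lv \<ge> t DD(u) \<ge> t (-Lv)\<^sup>2 / d\<close>. Hence \<open>t (-Lv) \<le> d\<close>. The second estimate is the first one,
  because \<open>Psi_tilde(v) - \<partial>\<^sub>t v = (m - 1) v (-Lv)\<close>.
\<close>

lemma C1_within_continuous_on:
  assumes "C1_within I f"
  shows "continuous_on I f"
  using assms unfolding C1_within_def by (meson DERIV_continuous_on)

text \<open>The theorem states the flow equation with \<open>deriv\<close>, a choice operator that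
  carries information only where the function is differentiable. At interior times the one-sided
  notion becomes two-sided and makes \<open>deriv\<close> a genuine derivative.\<close>

lemma C1_within_DERIV:
  assumes "C1_within I f" "t \<in> interior I"
  shows "(f has_real_derivative deriv f t) (at t)"
proof -
  have "t \<in> I"
    using assms(2) interior_subset by blast
  then obtain D where "(f has_real_derivative D) (at t within I)"
    using assms(1) unfolding C1_within_def by blast
  then have "(f has_real_derivative D) (at t)"
    by (simp only: at_within_interior[OF assms(2)])
  then show ?thesis
    using DERIV_imp_deriv by metis
qed

lemma pressure_pos:
  assumes "m > 1" "u x > 0"
  shows "pressure m u x > 0"
  using assms by (simp add: pressure_def)

text \<open>The factor m/(m-1) cancels the exponent brought down by differentiation. What remains is
  exactly the weight occurring in \<open>DD\<close>.\<close>

lemma DERIV_pressure: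
  assumes "m > 1" "u t x > 0" "((\<lambda>s. u s x) has_real_derivative D) (at t)"
  shows "((\<lambda>s. pressure m (u s) x) has_real_derivative m * u t x powr (m - 2) * D) (at t)"
proof -
  have "((\<lambda>s. m / (m - 1) * u s x powr (m - 1)) has_real_derivative
           m / (m - 1) * ((m - 1) * u t x powr (m - 1 - of_nat 1) * D)) (at t)"
    by (intro DERIV_cmult DERIV_fun_powr assms)
  then show ?thesis
    using assms(1) by (simp add: pressure_def mult.assoc)
qed

lemma DERIV_gen:
  assumes "x \<in> X" "\<And>y. y \<in> X \<Longrightarrow> ((\<lambda>s. f s y) has_real_derivative D y) (at t)"
  shows "((\<lambda>s. gen X k (f s) x) has_real_derivative gen X k D x) (at t)"
  unfolding gen_def using assms by (intro DERIV_sum DERIV_cmult DERIV_diff)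

lemma continuous_on_gen:
  assumes "x \<in> X" "\<And>y. y \<in> X \<Longrightarrow> continuous_on S (\<lambda>s. f s y)"
  shows "continuous_on S (\<lambda>s. gen X k (f s) x)"
  unfolding gen_def using assms by (intro continuous_intros)

text \<open>Each summand of \<open>DD\<close> is a difference g(y) - g(x) with g = m u^(m-2) L(u^m).
  Along the flow g is the time derivative of the pressure, so \<open>DD\<close> is the generator
  applied to it.\<close>

lemma DD_eq_gen:
  "DD X k m u x = gen X k (\<lambda>y. m * u y powr (m - 2) * gen X k (\<lambda>z. u z powr m) y) x"
  unfolding DD_def gen_def[of X k "\<lambda>y. _ y * gen _ _ _ y"] sum_distrib_left
  by (intro sum.cong) (auto simp: algebra_simps)

text \<open>A pointwise algebraic identity, checked summand by summand: the mixed term of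
  \<open>Psi_tilde\<close> cancels against the u(y)^m part of the subtracted term, and the squares
  combine. Along the flow that subtracted term is the time derivative of the pressure.\<close>

lemma Psi_tilde_pressure:
  assumes "m > 1"
  shows "Psi_tilde X k m (pressure m u) x - m * u x powr (m - 2) * gen X k (\<lambda>y. u y powr m) x
       = (m - 1) * pressure m u x * (- gen X k (pressure m u) x)"
proof -
  define c where "c = m / (m - 1)"
  define V where "V = pressure m u"
  have c: "c > 0" "(m - 1) * c = m" "(m - 1)\<^sup>2 / m * c\<^sup>2 = m"
    using assms(1) by (simp_all add: c_def power2_eq_square)
  \<comment> \<open>The two exponents of V add up to 2, so the constants contribute c^2, and the
    prefactor turns this into m.\<close>
  have mixed: "(m - 1)\<^sup>2 / m * V x powr ((m - 2) / (m - 1)) * V y powr (m / (m - 1))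
      = m * u x powr (m - 2) * u y powr m" for y
  proof -
    have "(m - 2) / (m - 1) + m / (m - 1) = 2"
      using assms(1) by (simp flip: add_divide_distrib add: divide_eq_eq)
    then have "c powr ((m - 2) / (m - 1)) * c powr (m / (m - 1)) = c\<^sup>2"
      using c by (simp flip: powr_add)
    moreover have "V x powr ((m - 2) / (m - 1)) = c powr ((m - 2) / (m - 1)) * u x powr (m - 2)"
      "V y powr (m / (m - 1)) = c powr (m / (m - 1)) * u y powr m"
      using assms(1) by (simp_all add: V_def pressure_def powr_mult powr_powr c(2) flip: c_def)
    ultimately have "V x powr ((m - 2) / (m - 1)) * V y powr (m / (m - 1))
        = c\<^sup>2 * u x powr (m - 2) * u y powr m"
      by (simp add: ac_simps)
    then show ?thesis
      by (metis c(3) mult.assoc)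
  qed
  have diag: "m * u x powr (m - 2) * u x powr m = (m - 1)\<^sup>2 / m * (V x)\<^sup>2"
  proof -
    have "u x powr (m - 2) * u x powr m = (u x powr (m - 1))\<^sup>2"
      by (simp add: power2_eq_square flip: powr_add)
    moreover have "(m - 1)\<^sup>2 / m * (V x)\<^sup>2 = m * (u x powr (m - 1))\<^sup>2"
      unfolding V_def pressure_def c_def[symmetric] power_mult_distrib
      using c(3) by (metis mult.assoc)
    ultimately show ?thesis
      by (simp add: mult.assoc)
  qed
  \<comment> \<open>The diagonal part of L(u^m) supplies the missing square: (m-1)/m + (m-1)^2/m =
    m-1.\<close>
  have summand: "(m - 1) / m * (V x)\<^sup>2 + m * u x powr (m - 2) * u y powr m - (m - 1) * V x * V y
      - m * u x powr (m - 2) * (u y powr m - u x powr m) = (m - 1) * V x * (V x - V y)" for y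
  proof -
    have "(m - 1) / m * (V x)\<^sup>2 + (m - 1)\<^sup>2 / m * (V x)\<^sup>2 = (m - 1) * (V x)\<^sup>2"
      using assms(1) by (simp add: field_simps power2_eq_square)
    with diag show ?thesis
      by (simp add: algebra_simps power2_eq_square)
  qed
  have "Psi_tilde X k m V x = (\<Sum>y\<in>X. k x y * ((m - 1) / m * (V x)\<^sup>2
      + m * u x powr (m - 2) * u y powr m - (m - 1) * V x * V y))"
    unfolding Psi_tilde_def mixed ..
  then have "Psi_tilde X k m V x - m * u x powr (m - 2) * gen X k (\<lambda>y. u y powr m) x
      = (\<Sum>y\<in>X. k x y * ((m - 1) / m * (V x)\<^sup>2 + m * u x powr (m - 2) * u y powr m
          - (m - 1) * V x * V y - m * u x powr (m - 2) * (u y powr m - u x powr m)))"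
    unfolding gen_def sum_distrib_left
    by (simp only: sum_subtractf[symmetric] right_diff_distrib mult.left_commute)
  also have "\<dots> = (m - 1) * V x * (- gen X k V x)"
    unfolding summand gen_def sum_distrib_left sum_negf[symmetric]
    by (intro sum.cong) (simp_all add: algebra_simps)
  finally show ?thesis
    by (simp add: V_def)
qed

text \<open>A maximum principle with \<open>F\<close> in the role of -Lv and \<open>G\<close> in
  that of \<open>DD\<close>. The bound d/t is the solution of f' = -f^2/d that blows up at time
  0.\<close>

lemma time_scaled_bound:
  fixes F :: "real \<Rightarrow> 'a \<Rightarrow> real"
  assumes "finite X" "d > 0"
    and cont: "\<And>x. x \<in> X \<Longrightarrow> continuous_on {0..} (\<lambda>t. F t x)"
    and deriv: "\<And>t x. t > 0 \<Longrightarrow> x \<in> X \<Longrightarrow> ((\<lambda>t. F t x) has_real_derivative - G t x) (at t)"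
    and curv: "\<And>t x. t > 0 \<Longrightarrow> x \<in> X \<Longrightarrow> F t x > 0 \<Longrightarrow> (\<And>y. y \<in> X \<Longrightarrow> F t y \<le> F t x)
                 \<Longrightarrow> G t x \<ge> (F t x)\<^sup>2 / d"
    and T: "T > 0" and z: "z \<in> X"
  shows "F T z \<le> d / T"
proof -
  \<comment> \<open>The maximum over [0,T] x X is taken in two stages, first in time by compactness,
    then over the finite set \<open>X\<close>, which carries no topology.\<close>
  have "\<exists>s\<in>{0..T}. \<forall>t\<in>{0..T}. t * F t x \<le> s * F s x" if "x \<in> X" for x
    using T by (intro continuous_attains_sup continuous_on_mult continuous_on_id
        continuous_on_subset[OF cont[OF that]]) auto
  then obtain s where s: "\<And>x. x \<in> X \<Longrightarrow> s x \<in> {0..T}"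
    "\<And>x t. x \<in> X \<Longrightarrow> t \<in> {0..T} \<Longrightarrow> t * F t x \<le> s x * F (s x) x"
    by metis
  obtain x where x: "x \<in> X" "\<And>y. y \<in> X \<Longrightarrow> s y * F (s y) y \<le> s x * F (s x) x"
  proof -
    let ?M = "(\<lambda>y. s y * F (s y) y) ` X"
    have "finite ?M" "?M \<noteq> {}"
      using z \<open>finite X\<close> by auto
    then show ?thesis
      using Max_in[of ?M] Max_ge[of ?M] that by fastforce
  qed
  define r where "r = s x"
  have max: "t * F t y \<le> r * F r x" if "y \<in> X" "t \<in> {0..T}" for t y
    using s(2)[OF that] x(2)[OF that(1)] by (simp add: r_def)
  have r: "0 \<le> r" "r \<le> T"
    using s(1)[OF x(1)] by (auto simp: r_def)
  have "r * F r x \<le> d"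
  proof (rule ccontr)
    assume gt: "\<not> r * F r x \<le> d"
    \<comment> \<open>The product vanishes at time 0 but exceeds d > 0 at \<open>r\<close>.\<close>
    then have "r > 0" "r * F r x > 0"
      using r \<open>d > 0\<close> by (auto simp: less_le)
    then have "F r x > 0"
      by (simp add: zero_less_mult_iff)
    \<comment> \<open>Comparing at the common time \<open>r\<close> and dividing by \<open>r\<close>
      gives maximality in space.\<close>
    have "F r y \<le> F r x" if "y \<in> X" for y
      using max[OF that, of r] r \<open>r > 0\<close> by simp
    then have "(F r x)\<^sup>2 / d \<le> G r x"
      using curv \<open>r > 0\<close> x(1) \<open>F r x > 0\<close> by blast
    then have "r * ((F r x)\<^sup>2 / d) \<le> r * G r x"
      using \<open>r > 0\<close> by (intro mult_left_mono) auto
    moreover have "F r x < r * ((F r x)\<^sup>2 / d)"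
      using gt \<open>F r x > 0\<close> \<open>d > 0\<close> by (simp add: field_simps power2_eq_square)
    ultimately have "F r x - r * G r x < 0"
      by simp
    moreover have "((\<lambda>t. t * F t x) has_real_derivative F r x - r * G r x) (at r)"
      using deriv[OF \<open>r > 0\<close> x(1)] by (auto intro!: derivative_eq_intros)
    \<comment> \<open>Only earlier times are compared, because \<open>r\<close> may be the right
      endpoint \<open>T\<close>.\<close>
    ultimately obtain e where e: "e > 0" "\<And>h. 0 < h \<Longrightarrow> h < e \<Longrightarrow> r * F r x < (r - h) * F (r - h) x"
      using DERIV_neg_dec_left by blast
    \<comment> \<open>The cap at \<open>r\<close> keeps r - h inside [0,T], where the maximality of
      \<open>r\<close> applies.\<close>
    define h where "h = min r (e / 2)"
    have "0 < h" "h < e" "h \<le> r"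
      using \<open>r > 0\<close> e(1) by (auto simp: h_def)
    with e(2)[of h] max[OF x(1), of "r - h"] r show False
      by auto
  qed
  with max[OF z, of T] T show ?thesis
    by (simp add: field_simps)
qed

theorem corollary5p2:
  fixes X :: "'a set" and k :: "'a \<Rightarrow> 'a \<Rightarrow> real"
    and m d :: real and u :: "real \<Rightarrow> 'a \<Rightarrow> real" and v :: "real \<Rightarrow> 'a \<Rightarrow> real"
  assumes "m > 1"
    and "finite X" and "X \<noteq> {}"
    and "kernel_on X k"
    and "d > 0" and "CD X k m d"
    and "\<And>t x. t \<ge> 0 \<Longrightarrow> x \<in> X \<Longrightarrow> u t x > 0"
    and "\<And>x. x \<in> X \<Longrightarrow> C1_within {0..} (\<lambda>t. u t x)"
    and "\<And>t x. t > 0 \<Longrightarrow> x \<in> X \<Longrightarrow>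
           deriv (\<lambda>s. u s x) t - gen X k (\<lambda>y. u t y powr m) x = 0"
  defines "v \<equiv> \<lambda>t. pressure m (u t)"
  shows "(\<forall>t>0. \<forall>x\<in>X. - gen X k (v t) x \<le> d / t) \<and>
         (\<forall>t>0. \<forall>x\<in>X.
            Psi_tilde X k m (v t) x / ((m - 1) * v t x)
            - deriv (\<lambda>s. v s x) t / ((m - 1) * v t x) \<le> d / t)"
proof -
  have "((\<lambda>s. u s x) has_real_derivative gen X k (\<lambda>y. u t y powr m) x) (at t)"
    if "t > 0" "x \<in> X" for t x
    using C1_within_DERIV[OF assms(8)[OF that(2)], of t] assms(9)[OF that] that(1) by simp
  then have Dv: "((\<lambda>s. v s x) has_real_derivative
      m * u t x powr (m - 2) * gen X k (\<lambda>y. u t y powr m) x) (at t)"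
    if "t > 0" "x \<in> X" for t x
    unfolding v_def using that assms(1,7) by (intro DERIV_pressure) auto
  have bound: "- gen X k (v t) x \<le> d / t" if "t > 0" "x \<in> X" for t x
  proof (rule time_scaled_bound[OF \<open>finite X\<close> \<open>d > 0\<close> _ _ _ that,
        where F = "\<lambda>t x. - gen X k (v t) x" and G = "\<lambda>t. DD X k m (u t)"])
    have "continuous_on {0..} (\<lambda>t. v t x)" if "x \<in> X" for x
      using C1_within_continuous_on[OF assms(8)[OF that]] assms(7) that
      unfolding v_def pressure_def
      by (intro continuous_intros) (auto simp: less_le)
    then show "continuous_on {0..} (\<lambda>t. - gen X k (v t) x)" if "x \<in> X" for x
      using that by (intro continuous_on_minus continuous_on_gen)
  next
    fix t x assume "t > (0::real)" "x \<in> X"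
    then show "((\<lambda>t. - gen X k (v t) x) has_real_derivative - DD X k m (u t) x) (at t)"
      unfolding DD_eq_gen by (intro DERIV_minus DERIV_gen Dv)
  next
    fix t x
    assume "t > (0::real)" "x \<in> X" "- gen X k (v t) x > 0"
      "\<And>y. y \<in> X \<Longrightarrow> - gen X k (v t) y \<le> - gen X k (v t) x"
    \<comment> \<open>The curvature condition asks for maximality among neighbours of x, which
      follows from maximality over all of \<open>X\<close>.\<close>
    then show "DD X k m (u t) x \<ge> (- gen X k (v t) x)\<^sup>2 / d"
      using assms(6,7) unfolding CD_def CD_at_def v_def by simp
  qed
  moreover have "Psi_tilde X k m (v t) x / ((m - 1) * v t x)
      - deriv (\<lambda>s. v s x) t / ((m - 1) * v t x) = - gen X k (v t) x" if "t > 0" "x \<in> X" for t x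
  proof -
    have "Psi_tilde X k m (v t) x - deriv (\<lambda>s. v s x) t = (m - 1) * v t x * (- gen X k (v t) x)"
      unfolding DERIV_imp_deriv[OF Dv[OF that]] unfolding v_def
      by (rule Psi_tilde_pressure[OF assms(1)])
    moreover have "(m - 1) * v t x \<noteq> 0"
      using pressure_pos[of m "u t" x] assms(1,7) that by (simp add: v_def)
    ultimately show ?thesis
      unfolding diff_divide_distrib[symmetric] by (metis nonzero_mult_div_cancel_left)
  qed
  ultimately show ?thesis
    by simp
qed

end
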